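(* Let $n\ge1$, $s\in\mathbb{R}$ and $f\in H^s(T^n)$. Let $u$ be the solution of the classical diffusion equation $u_t=\Delta u$ on $T^n$ with initial condition $u|_{t=0}=f$. For any $\delta>0$, let $u^{\delta,\beta}$ be the solution of the nonlocal diffusion equation $u^{\delta,\beta}_t=L^{\delta,\beta}u^{\delta,\beta}$ on $T^n$, $t>0$, with $u^{\delta,\beta}(\cdot,0)=f$. Then, for $t>0$ and $\beta\le n$, $$\lim_{\delta\to0^+}u^{\delta,\beta}(\cdot,t)=u(\cdot,t)\quad\text{in }H^s(T^n),$$ and for $t>0$ and $n<\beta\le n+2$, $$\lim_{\delta\to0^+}u^{\delta,\beta}(\cdot,t)=u(\cdot,t)\quad\text{in }H^\infty(T^n).$$
   Context: Let $r_1,\dots,r_n>0$ and let $T^n=\prod_{i=1}^n[0,r_i]$ be the periodic torus (opposite faces identified). For $k\in\mathbb{Z}^n$ put $\nu_k=\left(\frac{2\pi k_1}{r_1},\dots,\frac{2\pi k_n}{r_n}\right)$. A periodic distribution $h$ on $T^n$ is written through its Fourier coefficients as $h=\sum_{k\in\mathbb{Z}^n}\hat h_k e^{i\nu_k\cdot x}$. For $s\in\mathbb{R}$, $H^s(T^n)$ is the space of periodic distributions with $\|h\|_{H^s(T^n)}^2:=\sum_{k\in\mathbb{Z}^n}(1+\|k\|^2)^s|\hat h_k|^2<\infty$, and $H^\infty(T^n):=\bigcap_{s\in\mathbb{R}}H^s(T^n)$; convergence in $H^\infty(T^n)$ means convergence in $H^p(T^n)$ for every $p\in\mathbb{R}$.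 For $n\ge1$, $\delta>0$, $\beta<n+4$, the Fourier multiplier is $$m^{\delta,\beta}(\nu)=-\|\nu\|^2\;{}_2F_3\!\left(1,\tfrac{n+2-\beta}{2};\,2,\tfrac{n+2}{2},\tfrac{n+4-\beta}{2};\,-\tfrac14\|\nu\|^2\delta^2\right),\quad \nu\in\mathbb{R}^n.$$ For $\beta<n+2$ it equals $c^{\delta,\beta}\int_{B_\delta(0)}\frac{\cos(\nu\cdot z)-1}{\|z\|^\beta}dz$ with $c^{\delta,\beta}=\frac{2(n+2-\beta)\Gamma(\frac n2+1)}{\pi^{n/2}\delta^{n+2-\beta}}$; for $\beta=n+2$ it equals $-\|\nu\|^2$. The operator $L^{\delta,\beta}$ acts by $L^{\delta,\beta}J=\sum_{k}m^{\delta,\beta}(\nu_k)\hat J_k e^{i\nu_k\cdot x}$. The solutions have Fourier coefficients $\hat u^{\delta,\beta}_k(t)=\hat f_k e^{m^{\delta,\beta}(\nu_k)t}$ and $\hat u_k(t)=\hat f_k e^{-\|\nu_k\|^2t}$. *)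

theory Defs
  imports "HOL-Analysis.Analysis"
begin

text \<open>
  The torus is described by its vector of side lengths \<open>r\<close>; functions on it are \<open>r\<close>-periodic
  functions on \<open>real ^ 'n\<close>, and periodic distributions are continuous linear functionals on the
  smooth periodic functions. Such a functional is a total HOL function, and only its values on test
  functions are meaningful.
\<close>

definition pderiv_at :: "'n \<Rightarrow> (real ^ 'n \<Rightarrow> complex) \<Rightarrow> real ^ 'n \<Rightarrow> complex" where
  "pderiv_at i \<phi> = (\<lambda>x. frechet_derivative \<phi> (at x) (axis i 1))"

definition iterated_pderiv :: "'n list \<Rightarrow> (real ^ 'n \<Rightarrow> complex) \<Rightarrow> real ^ 'n \<Rightarrow> complex" where
  "iterated_pderiv is \<phi> = foldr pderiv_at is \<phi>"

definition smooth :: "(real ^ 'n \<Rightarrow> complex) \<Rightarrow> bool" where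
  "smooth \<phi> \<longleftrightarrow> (\<forall>is. iterated_pderiv is \<phi> differentiable_on UNIV)"

definition test_function :: "real ^ 'n \<Rightarrow> (real ^ 'n \<Rightarrow> complex) \<Rightarrow> bool" where
  "test_function r \<phi> \<longleftrightarrow> smooth \<phi> \<and> (\<forall>x i. \<phi> (x + axis i (r $ i)) = \<phi> x)"

type_synonym 'n functional = "(real ^ 'n \<Rightarrow> complex) \<Rightarrow> complex"

text \<open>Continuity is the usual estimate by finitely many of the seminorms of the Frechet space of
  test functions; a multi-index is represented by any list enumerating it.\<close>

definition distribution :: "real ^ 'n \<Rightarrow> 'n functional \<Rightarrow> bool" where
  "distribution r h \<longleftrightarrow>
     (\<forall>\<phi> \<psi>. test_function r \<phi> \<longrightarrow> test_function r \<psi> \<longrightarrow> h (\<lambda>x. \<phi> x + \<psi> x) = h \<phi> + h \<psi>) \<and>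
     (\<forall>c \<phi>. test_function r \<phi> \<longrightarrow> h (\<lambda>x. c * \<phi> x) = c * h \<phi>) \<and>
     (\<exists>C N. \<forall>\<phi>. test_function r \<phi> \<longrightarrow>
        norm (h \<phi>) \<le> C * (\<Sum>is | length is \<le> N. SUP x. norm (iterated_pderiv is \<phi> x)))"

definition freq :: "real ^ 'n \<Rightarrow> int ^ 'n \<Rightarrow> real ^ 'n" where
  "freq r k = (\<chi> i. 2 * pi * real_of_int (k $ i) / r $ i)"

definition wave :: "real ^ 'n \<Rightarrow> int ^ 'n \<Rightarrow> real ^ 'n \<Rightarrow> complex" where
  "wave r k x = exp (\<i> * complex_of_real (freq r k \<bullet> x))"

definition fourier_coeff :: "real ^ 'n \<Rightarrow> 'n functional \<Rightarrow> int ^ 'n \<Rightarrow> complex" where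
  "fourier_coeff r h k = h (wave r (- k)) / complex_of_real (\<Prod>i\<in>UNIV. r $ i)"

text \<open>The distribution given by a continuous periodic function.\<close>

definition function_distribution :: "real ^ 'n \<Rightarrow> (real ^ 'n \<Rightarrow> complex) \<Rightarrow> 'n functional" where
  "function_distribution r g = (\<lambda>\<phi>. integral (cbox 0 r) (\<lambda>x. g x * \<phi> x))"

definition sobolev_term :: "real ^ 'n \<Rightarrow> real \<Rightarrow> 'n functional \<Rightarrow> int ^ 'n \<Rightarrow> real" where
  "sobolev_term r s h k =
     (1 + (norm (\<chi> i. real_of_int (k $ i)))\<^sup>2) powr s * (norm (fourier_coeff r h k))\<^sup>2"

definition sobolev_space :: "real ^ 'n \<Rightarrow> real \<Rightarrow> 'n functional set" where
  "sobolev_space r s = {h. distribution r h \<and> sobolev_term r s h summable_on UNIV}"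

definition sobolev_norm :: "real ^ 'n \<Rightarrow> real \<Rightarrow> 'n functional \<Rightarrow> real" where
  "sobolev_norm r s h = sqrt (\<Sum>\<^sub>\<infinity>k. sobolev_term r s h k)"

text \<open>Limits as the positive parameter \<open>\<delta>\<close> tends to 0 of a family in the respective space.\<close>

definition sobolev_limit ::
    "real ^ 'n \<Rightarrow> real \<Rightarrow> (real \<Rightarrow> 'n functional) \<Rightarrow> 'n functional \<Rightarrow> bool" where
  "sobolev_limit r s v w \<longleftrightarrow>
     w \<in> sobolev_space r s \<and> (\<forall>\<delta>>0. v \<delta> \<in> sobolev_space r s) \<and>
     ((\<lambda>\<delta>. sobolev_norm r s (\<lambda>\<phi>. v \<delta> \<phi> - w \<phi>)) \<longlongrightarrow> 0) (at_right 0)"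

definition sobolev_limit_infinity ::
    "real ^ 'n \<Rightarrow> (real \<Rightarrow> 'n functional) \<Rightarrow> 'n functional \<Rightarrow> bool" where
  "sobolev_limit_infinity r v w \<longleftrightarrow> (\<forall>p. sobolev_limit r p v w)"

definition laplacian :: "'n functional \<Rightarrow> 'n :: finite functional" where
  "laplacian h = (\<lambda>\<phi>. h (\<lambda>x. \<Sum>i\<in>UNIV. iterated_pderiv [i, i] \<phi> x))"

definition multiplier :: "real \<Rightarrow> real \<Rightarrow> real ^ 'n \<Rightarrow> real" where
  "multiplier \<delta> \<beta> \<nu> =
     (let n = real CARD('n) in
      - (norm \<nu>)\<^sup>2 *
        eval_fps (fps_hypergeo [1, (n + 2 - \<beta>) / 2] [2, (n + 2) / 2, (n + 4 - \<beta>) / 2] 1)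
          (- (1 / 4) * (norm \<nu>)\<^sup>2 * \<delta>\<^sup>2))"

text \<open>The Fourier series is summed in the weak sense, i.e. after pairing with a test function.\<close>

definition nonlocal_op :: "real ^ 'n \<Rightarrow> real \<Rightarrow> real \<Rightarrow> 'n functional \<Rightarrow> 'n functional" where
  "nonlocal_op r \<delta> \<beta> h =
     (\<lambda>\<phi>. \<Sum>\<^sub>\<infinity>k. complex_of_real (multiplier \<delta> \<beta> (freq r k)) * fourier_coeff r h k *
               function_distribution r (wave r k) \<phi>)"

text \<open>\<open>u\<close> solves \<open>u\<^sub>t = A u\<close> for positive times with initial value \<open>f\<close>, where the time derivative and
  the continuity at time 0 are those of distribution-valued functions (weak-* topology).\<close>

definition evolution_solution ::
    "real ^ 'n \<Rightarrow> ('n functional \<Rightarrow> 'n functional) \<Rightarrow> 'n functional \<Rightarrow> (real \<Rightarrow> 'n functional) \<Rightarrow> bool"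
  where
  "evolution_solution r A f u \<longleftrightarrow>
     (\<forall>t\<ge>0. distribution r (u t)) \<and>
     (\<forall>\<phi>. test_function r \<phi> \<longrightarrow>
        u 0 \<phi> = f \<phi> \<and>
        ((\<lambda>t. u t \<phi>) \<longlongrightarrow> f \<phi>) (at_right 0) \<and>
        (\<forall>t>0. ((\<lambda>\<tau>. u \<tau> \<phi>) has_vector_derivative A (u t) \<phi>) (at t)))"

end

theory Submission
  imports Defs
begin

text \<open>
  Testing the equations against plane waves gives scalar linear ODEs, so the solutions have Fourier
  coefficients \<open>f\<^sub>k exp (m t)\<close>, and the limits follow by dominated convergence from
  \<open>m(\<nu>) \<rightarrow> - \<parallel>\<nu>\<parallel>\<^sup>2\<close> as \<open>\<delta> \<rightarrow> 0\<close>, once \<open>m\<close> is bounded above uniformly in small \<open>\<delta>\<close>.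
  Write \<open>m(\<nu>) = - \<parallel>\<nu>\<parallel>\<^sup>2 g(z)\<close> with \<open>z = \<parallel>\<nu>\<parallel>\<^sup>2 \<delta>\<^sup>2 / 4\<close> and \<open>a = (n + 2 - \<beta>) / 2\<close>. The function
  \<open>z\<^sup>a g(z)\<close> is increasing, whence \<open>g \<ge> 0\<close> and even \<open>g(z) \<ge> min 1 ((z\<^sub>0 / z)\<^sup>a) / 2\<close>. The first bound
  suffices in \<open>H\<^sup>s\<close>; for \<open>a < 1\<close>, that is \<open>\<beta> > n\<close>, the second one makes \<open>exp (m t)\<close> decay faster than
  every power of \<open>\<parallel>\<nu>\<parallel>\<close>.
\<close>

section \<open>Plane waves and Fourier coefficients of solutions\<close>

lemma wave_has_derivative:
  "((\<lambda>x. c * wave r k x) has_derivative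
     (\<lambda>h. c * (\<i> * complex_of_real (freq r k \<bullet> h)) * wave r k x)) (at x)"
proof -
  have "((\<lambda>x. \<i> * complex_of_real (freq r k \<bullet> x)) has_derivative
      (\<lambda>h. \<i> * complex_of_real (freq r k \<bullet> h))) (at x)"
    by (auto intro!: derivative_eq_intros)
  from has_derivative_compose[OF this DERIV_exp[unfolded has_field_derivative_def]]
  show ?thesis
    unfolding wave_def by (auto dest: has_derivative_mult_right[of _ _ _ c] simp: mult_ac)
qed

lemma pderiv_at_wave:
  "pderiv_at i (\<lambda>x. c * wave r k x) = (\<lambda>x. c * (\<i> * complex_of_real (freq r k $ i)) * wave r k x)"
  unfolding pderiv_at_def
  by (simp add: frechet_derivative_at[OF wave_has_derivative, symmetric] inner_axis)

lemma iterated_pderiv_wave: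
  "iterated_pderiv is (wave r k) =
     (\<lambda>x. (\<Prod>i\<leftarrow>is. \<i> * complex_of_real (freq r k $ i)) * wave r k x)"
proof (induction "is")
  case (Cons i "is")
  have "iterated_pderiv (i # is) (wave r k) = pderiv_at i (iterated_pderiv is (wave r k))"
    by (simp add: iterated_pderiv_def)
  then show ?case unfolding Cons.IH pderiv_at_wave by (simp add: mult_ac)
qed (simp add: iterated_pderiv_def)

lemma wave_test_function:
  assumes "\<And>i. r $ i > 0"
  shows "test_function r (wave r k)"
proof -
  have "iterated_pderiv is (wave r k) differentiable_on UNIV" for "is"
    unfolding iterated_pderiv_wave differentiable_on_def differentiable_def
    using wave_has_derivative by (metis has_derivative_at_withinI)
  moreover have "wave r k (x + axis i (r $ i)) = wave r k x" for x i
  proof -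
    have "freq r k \<bullet> axis i (r $ i) = 2 * pi * of_int (k $ i)"
      using assms[of i] by (simp add: freq_def inner_axis)
    then show ?thesis
      by (simp add: wave_def inner_add_right distrib_left exp_add exp_eq_1 flip: of_real_mult)
  qed
  ultimately show ?thesis by (simp add: test_function_def smooth_def)
qed

lemma wave_mult: "wave r k x * wave r l x = wave r (k + l) x"
proof -
  have "freq r (k + l) = freq r k + freq r l"
    by (simp add: freq_def vec_eq_iff add_divide_distrib distrib_left)
  then show ?thesis
    by (simp add: wave_def inner_add_left distrib_left exp_add)
qed

lemma wave_0: "wave r 0 x = 1"
proof -
  have "freq r 0 = 0" by (simp add: freq_def vec_eq_iff)
  then show ?thesis by (simp add: wave_def)
qed

lemma freq_uminus: "freq r (- k) = - freq r k"
  by (simp add: freq_def vec_eq_iff)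

lemma wave_integrable: "wave r k integrable_on cbox a b"
  unfolding wave_def by (intro integrable_continuous continuous_intros)

lemma integral_wave_shift:
  "integral (cbox (a + c) (b + c)) (wave r k) = wave r k c * integral (cbox a b) (wave r k)"
proof -
  have "wave r k \<circ> (+) c = (\<lambda>x. wave r k c * wave r k x)"
    by (simp add: fun_eq_iff wave_def inner_add_right distrib_left exp_add)
  then show ?thesis
    by (simp flip: integral_shift_cbox_plus)
qed

text \<open>If \<open>k\<^sub>i \<noteq> 0\<close>, translating the period box by half a wavelength in direction \<open>i\<close> changes the sign
  of the integral, but by periodicity it does not change its value.\<close>

lemma integral_wave:
  fixes r :: "real ^ 'n"
  assumes r: "\<And>i. r $ i > 0"
  shows "integral (cbox 0 r) (wave r k) =
    (if k = 0 then complex_of_real (\<Prod>i\<in>UNIV. r $ i) else 0)"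
proof (cases "k = 0")
  case True
  have "0 \<in> cbox 0 r" using r by (auto simp: mem_box_cart less_imp_le)
  then have "measure lborel (cbox 0 r) = (\<Prod>i\<in>UNIV. r $ i)" by (subst content_cbox_cart) auto
  moreover have "wave r k = (\<lambda>x. 1)" using True by (simp add: fun_eq_iff wave_0)
  ultimately show ?thesis using True by (simp add: scaleR_conv_of_real)
next
  case False
  then obtain i where i: "k $ i \<noteq> 0" by (auto simp: vec_eq_iff)
  \<comment> \<open>Half a wavelength in direction \<open>i\<close>: \<open>freq r k $ i * s\<close>
    has absolute value \<open>pi\<close>, so the translation multiplies the wave by -1. It is
    shorter than the side \<open>r $ i\<close> because \<open>k $ i\<close> is a nonzero
    integer.\<close>
  define s where "s = r $ i / (2 * \<bar>real_of_int (k $ i)\<bar>)"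
  have "1 \<le> \<bar>real_of_int (k $ i)\<bar>" using i by linarith
  then have s: "0 < s" "s < r $ i"
    using r[of i] by (auto simp: s_def field_simps intro: less_le_trans[of _ "r $ i * 2"])
  define e where "e = (axis i 1 :: real ^ 'n)"
  have eB: "e \<in> Basis" by (simp add: e_def)
  have ei: "x \<bullet> e = x $ i" for x by (simp add: e_def inner_axis)
  have en: "e $ j = (if j = i then 1 else 0)" for j by (simp add: e_def axis_def)
  \<comment> \<open>\<open>b\<close> is the far corner of the slab of the box where coordinate
    \<open>i\<close> is at most \<open>s\<close>. Cutting the original box at \<open>s\<close> and
    the translated box at \<open>r $ i\<close> leaves one common piece and two slabs that differ by
    a full period.\<close>
  define b where "b = (\<chi> j. if j = i then s else r $ j)"
  let ?I = "\<lambda>A. integral A (wave r k)"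
  let ?a = "s *\<^sub>R e" and ?c = "(r $ i) *\<^sub>R e"
  have A1: "cbox 0 r \<inter> {x. x \<bullet> e \<le> s} = cbox 0 b"
    using s unfolding ei set_eq_iff Int_iff mem_Collect_eq mem_box_cart b_def
    by (smt (verit) vec_lambda_beta)
  have A2: "cbox 0 r \<inter> {x. x \<bullet> e \<ge> s} = cbox ?a r"
    using s unfolding ei set_eq_iff Int_iff mem_Collect_eq mem_box_cart
    by (simp add: en) (smt (verit))
  have B1: "cbox (0 + ?a) (r + ?a) \<inter> {x. x \<bullet> e \<le> r $ i} = cbox ?a r"
    using s unfolding ei set_eq_iff Int_iff mem_Collect_eq mem_box_cart
    by (simp add: en) (smt (verit))
  have B2: "cbox (0 + ?a) (r + ?a) \<inter> {x. x \<bullet> e \<ge> r $ i} = cbox (0 + ?c) (b + ?c)"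
    using s unfolding ei set_eq_iff Int_iff mem_Collect_eq mem_box_cart
    by (simp add: en b_def) (smt (verit))
  have "freq r k \<bullet> ?c = 2 * pi * of_int (k $ i)"
    using r[of i] by (simp add: freq_def ei)
  then have wc: "wave r k ?c = 1"
    by (simp add: wave_def exp_eq_1 flip: of_real_mult)
  have "freq r k \<bullet> ?a = pi * sgn (of_int (k $ i))"
    using r[of i] i by (simp add: freq_def ei s_def sgn_if)
  then have "wave r k ?a = - 1"
    using i by (auto simp: wave_def sgn_if exp_minus)
  then have "- ?I (cbox 0 r) = ?I (cbox (0 + ?a) (r + ?a))"
    unfolding integral_wave_shift by simp
  also have "\<dots> = ?I (cbox ?a r) + ?I (cbox (0 + ?c) (b + ?c))"
    unfolding integral_split[OF wave_integrable eB, of "0 + ?a" "r + ?a" r k "r $ i"] B1 B2 ..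
  also have "?I (cbox (0 + ?c) (b + ?c)) = ?I (cbox 0 b)"
    unfolding integral_wave_shift wc by simp
  also have "?I (cbox ?a r) + ?I (cbox 0 b) = ?I (cbox 0 r)"
    unfolding integral_split[OF wave_integrable eB, of 0 r r k s] A1 A2 by simp
  finally show ?thesis using False by simp
qed

section \<open>Action of the operators on Fourier coefficients and the resulting scalar
  equations\<close>

lemma fourier_coeff_nonlocal_op:
  assumes r: "\<And>i. r $ i > 0"
  shows "fourier_coeff r (nonlocal_op r \<delta> \<beta> h) k =
    complex_of_real (multiplier \<delta> \<beta> (freq r k)) * fourier_coeff r h k"
proof -
  have vol: "(\<Prod>i\<in>UNIV. r $ i) \<noteq> 0" using r by (simp add: less_imp_neq[symmetric])
  \<comment> \<open>Orthogonality of the plane waves: the weakly summed series collapses to its term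
    of index \<open>k\<close>, so no question of convergence arises.\<close>
  have "function_distribution r (wave r l) (wave r (- k)) =
      (if l = k then complex_of_real (\<Prod>i\<in>UNIV. r $ i) else 0)" for l
    unfolding function_distribution_def wave_mult using integral_wave[OF r, of "l - k"] by simp
  then have "nonlocal_op r \<delta> \<beta> h (wave r (- k)) =
      (\<Sum>\<^sub>\<infinity>l\<in>{k}. complex_of_real (multiplier \<delta> \<beta> (freq r l)) * fourier_coeff r h l *
         complex_of_real (\<Prod>i\<in>UNIV. r $ i))"
    unfolding nonlocal_op_def by (intro infsum_cong_neutral) auto
  then show ?thesis using vol by (simp add: fourier_coeff_def)
qed

text \<open>Plane waves are eigenfunctions of the Laplacian, which acts on the test function.
  Homogeneity of \<open>h\<close> on test functions then pulls out the eigenvalue.\<close>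

lemma fourier_coeff_laplacian:
  assumes r: "\<And>i. r $ i > 0" and h: "distribution r h"
  shows "fourier_coeff r (laplacian h) k =
    complex_of_real (- (norm (freq r k))\<^sup>2) * fourier_coeff r h k"
proof -
  have "(\<lambda>x. \<Sum>i\<in>UNIV. iterated_pderiv [i, i] (wave r (- k)) x) =
      (\<lambda>x. complex_of_real (- (norm (freq r k))\<^sup>2) * wave r (- k) x)"
    by (simp add: iterated_pderiv_wave freq_uminus power2_norm_eq_inner inner_vec_def
        sum_negf sum_distrib_left algebra_simps)
  moreover have "h (\<lambda>x. c * wave r (- k) x) = c * h (wave r (- k))" for c
    using h wave_test_function[OF r] by (auto simp: distribution_def)
  ultimately show ?thesis unfolding laplacian_def fourier_coeff_def by (simp only: times_divide_eq_right)
qed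

text \<open>Integrating factor. At 0 only a one-sided limit of \<open>y\<close> is given, so
  constancy is shown on the open half-line and the constant is identified by letting
  \<open>t\<close> tend to 0.\<close>

lemma linear_ode_solution:
  fixes y :: "real \<Rightarrow> complex" and m :: real
  assumes lim: "(y \<longlongrightarrow> y0) (at_right 0)"
    and deriv: "\<And>t. t > 0 \<Longrightarrow> (y has_vector_derivative of_real m * y t) (at t)"
    and t: "t > 0"
  shows "y t = of_real (exp (m * t)) * y0"
proof -
  define z where "z = (\<lambda>t. of_real (exp (- m * t)) * y t)"
  have "(z has_vector_derivative 0) (at t within {0<..})" if "t > 0" for t
    unfolding z_def using that
    by (auto intro!: derivative_eq_intros deriv has_vector_derivative_at_within[OF deriv]
        has_vector_derivative_of_real simp: algebra_simps)
  then obtain c where c: "\<And>t. t > 0 \<Longrightarrow> z t = c"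
    using has_vector_derivative_zero_constant[of "{0<..}" z] by (auto intro: convex_real_interval)
  have "(z \<longlongrightarrow> of_real (exp (- m * 0)) * y0) (at_right 0)"
    unfolding z_def by (intro tendsto_intros lim)
  moreover have "(z \<longlongrightarrow> c) (at_right 0)"
    by (rule tendsto_eventually) (use c in \<open>auto simp: eventually_at_filter\<close>)
  ultimately have "c = y0"
    using tendsto_unique[of "at_right (0::real)"] by fastforce
  then have "of_real (exp (m * t)) * y0 = of_real (exp (m * t)) * z t" using c t by simp
  also have "\<dots> = y t"
    by (simp add: z_def mult.assoc[symmetric] flip: of_real_mult exp_add)
  finally show ?thesis ..
qed

text \<open>Testing the evolution equation against \<open>wave r (- k)\<close> leaves a scalar
  linear equation with rate \<open>m\<close>.\<close>

lemma fourier_coeff_evolution_solution: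
  assumes r: "\<And>i. r $ i > 0" and u: "evolution_solution r A f u"
    and A: "\<And>h. distribution r h \<Longrightarrow> fourier_coeff r (A h) k = of_real m * fourier_coeff r h k"
    and t: "t > 0"
  shows "fourier_coeff r (u t) k = of_real (exp (m * t)) * fourier_coeff r f k"
proof -
  have vol: "(\<Prod>i\<in>UNIV. r $ i) \<noteq> 0" using r by (simp add: less_imp_neq[symmetric])
  let ?w = "wave r (- k)"
  have "A (u t) ?w = of_real m * u t ?w" if "t > 0" for t
    using A[of "u t"] u that vol by (simp add: evolution_solution_def fourier_coeff_def)
  moreover have "test_function r ?w" by (rule wave_test_function[OF r])
  ultimately have "u t ?w = of_real (exp (m * t)) * f ?w"
    using u t unfolding evolution_solution_def by (intro linear_ode_solution) auto
  then show ?thesis by (simp add: fourier_coeff_def)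
qed

section \<open>The hypergeometric functions\<close>

lemma pochhammer_mono:
  fixes a b :: "'a::linordered_semidom"
  assumes "0 \<le> a" "a \<le> b"
  shows "pochhammer a k \<le> pochhammer b k"
  using assms by (auto simp: pochhammer_prod intro!: prod_mono)

lemma pochhammer_ge_1:
  fixes a :: "'a::linordered_semidom"
  assumes "1 \<le> a"
  shows "1 \<le> pochhammer a k"
  using assms by (auto simp: pochhammer_prod intro!: prod_ge_1 add_increasing2)

text \<open>Comparison with the exponential series.\<close>

lemma fps_conv_radius_infinityI:
  fixes F :: "real fps"
  assumes "\<And>k. \<bar>fps_nth F k\<bar> \<le> C / fact k"
  shows "fps_conv_radius F = \<infinity>"
  unfolding fps_conv_radius_def
proof (rule conv_radius_inftyI'')
  fix z :: real
  have "summable (\<lambda>k. C * (\<bar>z\<bar> ^ k /\<^sub>R fact k))"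
    by (intro summable_mult summable_exp_generic)
  then show "summable (\<lambda>k. fps_nth F k * z ^ k)"
  proof (rule summable_comparison_test')
    fix k
    show "norm (fps_nth F k * z ^ k) \<le> C * (\<bar>z\<bar> ^ k /\<^sub>R fact k)"
      using mult_right_mono[OF assms[of k], of "\<bar>z\<bar> ^ k"]
      by (simp add: abs_mult power_abs divide_inverse mult_ac)
  qed
qed

lemma eval_fps_neg_has_derivative:
  fixes F :: "real fps"
  assumes "fps_conv_radius F = \<infinity>"
  shows "((\<lambda>z. eval_fps F (- z)) has_real_derivative - eval_fps (fps_deriv F) (- z)) (at z within S)"
proof -
  have "(eval_fps F has_field_derivative eval_fps (fps_deriv F) (- z)) (at (- z))"
    using assms by (intro has_field_derivative_eval_fps) simp
  from DERIV_chain2[of "eval_fps F" _ uminus z "- 1" S, OF this] show ?thesis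
    by (simp add: DERIV_minus[OF DERIV_ident])
qed

lemma fps_conv_radius_deriv_infinity:
  fixes F :: "real fps"
  assumes "fps_conv_radius F = \<infinity>"
  shows "fps_conv_radius (fps_deriv F) = \<infinity>"
  using fps_conv_radius_deriv[of F] assms by simp

lemma fps_conv_radius_mult_infinity:
  fixes F G :: "real fps"
  assumes "fps_conv_radius F = \<infinity>" "fps_conv_radius G = \<infinity>"
  shows "fps_conv_radius (F * G) = \<infinity>"
  using fps_conv_radius_mult[of F G] assms by simp

lemma fps_conv_radius_add_infinity:
  fixes F G :: "real fps"
  assumes "fps_conv_radius F = \<infinity>" "fps_conv_radius G = \<infinity>"
  shows "fps_conv_radius (F + G) = \<infinity>"
  using fps_conv_radius_add[of F G] assms by simp

text \<open>Only the first factor \<open>c\<close> of the Pochhammer symbol can be below 1, and it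
  is at least 1/2; hence its reciprocal is at most 2 and the coefficients are at most 2 /
  k!.\<close>

lemma fps_conv_radius_hypergeo_0_1:
  fixes c :: real
  assumes "c \<ge> 1 / 2"
  shows "fps_conv_radius (fps_hypergeo [] [c] 1) = \<infinity>"
proof -
  have "1 / pochhammer c k \<le> 2" for k
  proof (cases k)
    case (Suc j)
    have "1 / 2 * 1 \<le> c * pochhammer (c + 1) j"
      using pochhammer_ge_1[of "c + 1" j] assms by (intro mult_mono) auto
    then show ?thesis using Suc by (simp add: pochhammer_rec field_simps)
  qed simp
  then have "1 / pochhammer c k * (1 / fact k) \<le> 2 * (1 / fact k)" for k
    by (rule mult_right_mono) simp
  moreover have "pochhammer c k > 0" for k using assms by (intro pochhammer_pos) simp
  ultimately show ?thesis
    by (intro fps_conv_radius_infinityI[of _ 2]) (simp add: abs_of_pos)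
qed

text \<open>For \<open>c = n / 2\<close> the function \<open>z \<mapsto> \<^sub>0F\<^sub>1(; c; -z)\<close> is the Fourier transform of the uniform
  probability measure on the unit sphere at the points \<open>\<xi>\<close> with \<open>\<parallel>\<xi>\<parallel>\<^sup>2 = 4 z\<close>. The bound comes from the energy \<open>y\<^sup>2 + z y'\<^sup>2\<close> of the equation
  \<open>z y'' + c y' + y = 0\<close>, which is decreasing.\<close>

lemma hypergeo_0_1_le_1:
  fixes c z :: real
  assumes c: "c \<ge> 1 / 2" and z: "z \<ge> 0"
  shows "eval_fps (fps_hypergeo [] [c] 1) (- z) \<le> 1"
proof -
  define P where "P = fps_hypergeo [] [c] (1 :: real)"
  define P1 where "P1 = fps_deriv P"
  define P2 where "P2 = fps_deriv P1"
  have rad: "fps_conv_radius P = \<infinity>" "fps_conv_radius P1 = \<infinity>" "fps_conv_radius P2 = \<infinity>"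
    unfolding P_def P1_def P2_def using c
    by (simp_all add: fps_conv_radius_deriv_infinity fps_conv_radius_hypergeo_0_1)
  have rec: "(c + real k) * real (Suc k) * fps_nth P (Suc k) = fps_nth P k" for k
  proof -
    have nz: "(c + real k) * real (Suc k) \<noteq> 0" using c by auto
    have "(c + real k) * real (Suc k) * fps_nth P (Suc k) =
        (c + real k) * real (Suc k) / ((c + real k) * real (Suc k) * (pochhammer c k * fact k))"
      by (simp add: P_def pochhammer_Suc algebra_simps)
    also have "\<dots> = fps_nth P k"
      unfolding nonzero_divide_mult_cancel_left[OF nz] by (simp add: P_def)
    finally show ?thesis .
  qed
  \<comment> \<open>The coefficient recursion amounts to w P'' + c P' = P; substituting w = -z gives
    the equation for y(z) = P(-z).\<close>
  have "fps_X * P2 + fps_const c * P1 = P"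
  proof (rule fps_ext)
    show "fps_nth (fps_X * P2 + fps_const c * P1) k = fps_nth P k" for k
      using rec[of k] by (cases k) (auto simp: P1_def P2_def algebra_simps)
  qed
  moreover have "eval_fps (fps_X * P2 + fps_const c * P1) w = w * eval_fps P2 w + c * eval_fps P1 w" for w
    by (simp add: eval_fps_add eval_fps_mult fps_conv_radius_mult_infinity rad)
  ultimately have ode: "w * eval_fps P2 w + c * eval_fps P1 w = eval_fps P w" for w by simp
  define E where "E z = (eval_fps P (- z))\<^sup>2 + z * (eval_fps P1 (- z))\<^sup>2" for z
  have "(E has_real_derivative (1 - 2 * c) * (eval_fps P1 (- z))\<^sup>2) (at z)" for z
  proof -
    have "(E has_real_derivative
        2 * eval_fps P (- z) * - eval_fps P1 (- z) + ((eval_fps P1 (- z))\<^sup>2 +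
        z * (2 * eval_fps P1 (- z) * - eval_fps P2 (- z)))) (at z)"
      unfolding E_def P1_def P2_def
      by (auto intro!: derivative_eq_intros eval_fps_neg_has_derivative
          simp: rad[unfolded P1_def P2_def] algebra_simps)
    \<comment> \<open>Eliminating \<open>P\<close> by the differential equation cancels the second
      derivatives. The remaining factor 1 - 2 c is nonpositive exactly when c is at least 1/2; in
      the boundary case the energy is constant.\<close>
    also have "2 * eval_fps P (- z) * - eval_fps P1 (- z) + ((eval_fps P1 (- z))\<^sup>2 +
        z * (2 * eval_fps P1 (- z) * - eval_fps P2 (- z))) = (1 - 2 * c) * (eval_fps P1 (- z))\<^sup>2"
      unfolding ode[of "- z", symmetric] by (simp add: algebra_simps power2_eq_square)
    finally show ?thesis .
  qed
  moreover have "(1 - 2 * c) * (eval_fps P1 (- z))\<^sup>2 \<le> 0" for z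
    using c by (intro mult_nonpos_nonneg) auto
  ultimately have "E z \<le> E 0"
    using z by (intro DERIV_nonpos_imp_nonincreasing[of 0 z E]) blast+
  also have "E 0 = 1" by (simp add: E_def eval_fps_at_0 P_def)
  finally have "(eval_fps P (- z))\<^sup>2 + z * (eval_fps P1 (- z))\<^sup>2 \<le> 1" by (simp add: E_def)
  moreover have "0 \<le> z * (eval_fps P1 (- z))\<^sup>2" using z by simp
  ultimately have "(eval_fps P (- z))\<^sup>2 \<le> 1\<^sup>2" by simp
  then show ?thesis unfolding P_def[symmetric] by (rule power2_le_imp_le) simp
qed

section \<open>Monotonicity and lower bound for the hypergeometric factor of the multiplier\<close>

lemma fps_conv_radius_hypergeo_2_3:
  fixes a c :: real
  assumes "a \<ge> 0" "c \<ge> 0"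
  shows "fps_conv_radius (fps_hypergeo [1, a] [2, c + 1, a + 1] 1) = \<infinity>"
proof (rule fps_conv_radius_infinityI[of _ 1])
  fix k
  \<comment> \<open>Each of the three quotients lies between 0 and 1. The value a = 0, which is
    \<beta> = n + 2, is included: there the series reduces to its constant term 1.\<close>
  define q where "q = pochhammer 1 k / pochhammer 2 k * (pochhammer a k / pochhammer (a + 1) k) *
    (1 / pochhammer (c + 1) k)"
  have "pochhammer 1 k \<le> pochhammer (2::real) k" "pochhammer a k \<le> pochhammer (a + 1) k"
    "0 < pochhammer (1::real) k" "0 < pochhammer (a + 1) k"
    using assms by (intro pochhammer_mono pochhammer_pos; simp)+
  moreover have "1 \<le> pochhammer (c + 1) k" using assms by (intro pochhammer_ge_1) simp
  moreover have "0 \<le> pochhammer a k" using assms by (simp add: pochhammer_prod prod_nonneg)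
  ultimately have bounds: "0 \<le> q" "q \<le> 1 * 1 * 1"
    unfolding q_def by (intro mult_nonneg_nonneg mult_mono; simp)+
  have "fps_nth (fps_hypergeo [1, a] [2, c + 1, a + 1] 1) k =
      q * (1 / fact k)"
    by (simp add: q_def)
  then show "\<bar>fps_nth (fps_hypergeo [1, a] [2, c + 1, a + 1] 1) k\<bar> \<le> 1 / fact k"
    using bounds by (simp add: abs_mult divide_right_mono)
qed

text \<open>The operator w d/dw + a multiplies the k-th coefficient of \<open>F\<close> by k + a,
  which cancels the parameters a and a + 1. What is left is a c times the coefficient of index k + 1
  of the function 0F1, and the outer factor w aligns the indices.\<close>

lemma hypergeo_2_3_relation:
  fixes a c w :: real
  assumes a: "a \<ge> 0" and c: "c \<ge> 1 / 2"
  defines "F \<equiv> fps_hypergeo [1, a] [2, c + 1, a + 1] 1"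
  shows "w * (w * eval_fps (fps_deriv F) w + a * eval_fps F w) =
    a * c * (eval_fps (fps_hypergeo [] [c] 1) w - 1)"
proof -
  define P where "P = fps_hypergeo [] [c] (1 :: real)"
  have rad: "fps_conv_radius F = \<infinity>" "fps_conv_radius (fps_deriv F) = \<infinity>" "fps_conv_radius P = \<infinity>"
    unfolding F_def P_def using a c
    by (simp_all add: fps_conv_radius_deriv_infinity fps_conv_radius_hypergeo_0_1
        fps_conv_radius_hypergeo_2_3)
  have coeff: "(real k + a) * fps_nth F k = a * c * fps_nth P (Suc k)" for k
  proof -
    have *: "pochhammer (2::real) k = fact (Suc k)"
      using pochhammer_rec[of "1::real" k] by (simp add: pochhammer_fact)
    have "(real k + a) * pochhammer a k = a * pochhammer (a + 1) k"
      by (metis add.commute mult.commute pochhammer_Suc pochhammer_rec)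
    moreover have "0 < pochhammer (a + 1) k" "0 < pochhammer (c + 1) k"
      using a c by (auto intro!: pochhammer_pos)
    moreover have "(real k + a) * fps_nth F k =
        ((real k + a) * pochhammer a k) / (fact (Suc k) * pochhammer (c + 1) k * pochhammer (a + 1) k)"
      by (simp add: F_def * pochhammer_fact[symmetric] mult_ac del: fact_Suc)
    ultimately show ?thesis
      using c by (simp add: P_def pochhammer_rec[of c] mult_ac del: fact_Suc)
  qed
  \<comment> \<open>The added constant accounts for index 0, where \<open>P\<close> has coefficient
    1.\<close>
  have "fps_X * (fps_X * fps_deriv F + fps_const a * F) + fps_const (a * c) = fps_const (a * c) * P"
  proof (rule fps_ext)
    fix k
    show "fps_nth (fps_X * (fps_X * fps_deriv F + fps_const a * F) + fps_const (a * c)) k =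
        fps_nth (fps_const (a * c) * P) k"
    proof (cases k)
      case (Suc j)
      have "fps_nth (fps_X * fps_deriv F + fps_const a * F) j = (real j + a) * fps_nth F j"
        by (cases j) (auto simp: distrib_right)
      then show ?thesis using coeff[of j] Suc by simp
    qed (simp add: P_def)
  qed
  then have "eval_fps (fps_X * (fps_X * fps_deriv F + fps_const a * F) + fps_const (a * c)) w =
      eval_fps (fps_const (a * c) * P) w"
    by simp
  then show ?thesis
    unfolding P_def[symmetric]
    by (simp add: eval_fps_add eval_fps_mult fps_conv_radius_mult_infinity
        fps_conv_radius_add_infinity rad algebra_simps)
qed

text \<open>The function \<open>g z = \<^sub>2F\<^sub>3(1, a; 2, c + 1, a + 1; -z)\<close> satisfies
  \<open>z\<^sup>2 g' + a z g = a c (1 - \<^sub>0F\<^sub>1(; c; -z)) \<ge> 0\<close>, so \<open>z\<^sup>a g\<close> is increasing.\<close>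

lemma hypergeo_2_3_powr_mono:
  fixes a c x y :: real
  assumes a: "a \<ge> 0" and c: "c \<ge> 1 / 2" and xy: "0 < x" "x \<le> y"
  defines "g \<equiv> \<lambda>z. eval_fps (fps_hypergeo [1, a] [2, c + 1, a + 1] 1) (- z)"
  shows "x powr a * g x \<le> y powr a * g y"
proof -
  define F where "F = fps_hypergeo [1, a] [2, c + 1, a + 1] (1::real)"
  define g' where "g' z = - eval_fps (fps_deriv F) (- z)" for z
  have der: "(g has_real_derivative g' z) (at z)" for z
    unfolding g_def g'_def F_def using a c
    by (intro eval_fps_neg_has_derivative fps_conv_radius_hypergeo_2_3) auto
  have nonneg: "0 \<le> a * g z + z * g' z" if "z > 0" for z
  proof -
    have "z * (a * g z + z * g' z) = a * c * (1 - eval_fps (fps_hypergeo [] [c] 1) (- z))"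
      using hypergeo_2_3_relation[OF a c, of "- z", folded F_def]
      by (simp add: g_def g'_def F_def algebra_simps)
    also have "\<dots> \<ge> 0"
      using hypergeo_0_1_le_1[OF c, of z] a c that by simp
    finally show ?thesis using that by (simp add: zero_le_mult_iff)
  qed
  show ?thesis
  proof (rule DERIV_nonneg_imp_nondecreasing[OF xy(2)])
    fix z assume "x \<le> z" "z \<le> y"
    then have z: "z > 0" using xy by simp
    have "((\<lambda>z. z powr a * g z) has_real_derivative z powr (a - 1) * (a * g z + z * g' z)) (at z)"
      using z by (auto intro!: derivative_eq_intros der simp: algebra_simps powr_diff)
    moreover have "0 \<le> z powr (a - 1) * (a * g z + z * g' z)"
      using nonneg[OF z] by simp
    ultimately show "\<exists>D. ((\<lambda>z. z powr a * g z) has_real_derivative D) (at z) \<and> 0 \<le> D" by blast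
  qed
qed

text \<open>Continuity and g(0) = 1 give g > 1/2 on [0, z0]; beyond z0, the monotonicity of z^a g(z)
  propagates the bound at z0.\<close>

lemma hypergeo_2_3_lower_bound:
  fixes a c :: real
  assumes a: "a \<ge> 0" and c: "c \<ge> 1 / 2"
  defines "g \<equiv> \<lambda>z. eval_fps (fps_hypergeo [1, a] [2, c + 1, a + 1] 1) (- z)"
  shows "\<exists>z0>0. \<forall>z\<ge>0. min 1 ((z0 / z) powr a) / 2 \<le> g z"
proof -
  have "continuous (at 0) g"
    unfolding g_def using a c
    by (intro DERIV_isCont[OF eval_fps_neg_has_derivative] fps_conv_radius_hypergeo_2_3) auto
  moreover have "g 0 = 1" by (simp add: g_def eval_fps_at_0)
  ultimately have "\<forall>\<^sub>F z in at 0. g z > 1 / 2"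
    unfolding continuous_at by (intro order_tendstoD) auto
  then obtain e where e: "e > 0" "\<And>z. z \<noteq> 0 \<Longrightarrow> \<bar>z\<bar> < e \<Longrightarrow> g z > 1 / 2"
    by (auto simp: eventually_at dist_real_def)
  define z0 where "z0 = e / 2"
  have z0: "z0 > 0" "z0 < e" using e by (auto simp: z0_def)
  have small: "g z > 1 / 2" if "0 \<le> z" "z \<le> z0" for z
    using that e(2)[of z] z0 \<open>g 0 = 1\<close> by (cases "z = 0") auto
  have "g z \<ge> min 1 ((z0 / z) powr a) / 2" if "z \<ge> 0" for z
  proof (cases "z \<le> z0")
    case True
    \<comment> \<open>The minimum is at most 1; this also covers z = 0, where \<open>z0 / z\<close>
      is 0 by convention.\<close>
    then show ?thesis using small[OF that] by linarith
  next
    case False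
    have "z0 powr a * (1 / 2) \<le> z0 powr a * g z0"
      using small[of z0] z0 by (intro mult_left_mono) auto
    also have "\<dots> \<le> z powr a * g z"
      unfolding g_def using False z0 by (intro hypergeo_2_3_powr_mono a c) auto
    finally have "(z0 / z) powr a / 2 \<le> g z"
      using False z0 by (simp add: powr_divide field_simps)
    then show ?thesis by linarith
  qed
  then show ?thesis using z0 by blast
qed

section \<open>Convergence in Sobolev spaces\<close>

text \<open>Dominated convergence for unordered sums: by the Weierstrass M-test the finite partial
  sums converge uniformly in \<open>x\<close>, so the two limits may be exchanged.\<close>

lemma tendsto_infsum_zero:
  fixes f :: "'a::metric_space \<Rightarrow> 'b \<Rightarrow> 'c::banach"
  assumes lim: "\<And>k. ((\<lambda>x. f x k) \<longlongrightarrow> 0) (at a within S)"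
    and bound: "\<And>x k. x \<in> S \<Longrightarrow> norm (f x k) \<le> M k"
    and M: "M summable_on UNIV"
  shows "((\<lambda>x. \<Sum>\<^sub>\<infinity>k. f x k) \<longlongrightarrow> 0) (at a within S)"
proof (rule swap_uniform_limit)
  show "uniform_limit S (\<lambda>X x. \<Sum>k\<in>X. f x k) (\<lambda>x. \<Sum>\<^sub>\<infinity>k. f x k) (finite_subsets_at_top UNIV)"
    using bound M by (intro Weierstrass_m_test_general[where M = M]) auto
  show "\<forall>\<^sub>F X in finite_subsets_at_top UNIV. ((\<lambda>x. \<Sum>k\<in>X. f x k) \<longlongrightarrow> 0) (at a within S)"
    by (intro always_eventually allI tendsto_null_sum lim)
qed auto

lemma fourier_coeff_diff:
  "fourier_coeff r (\<lambda>\<phi>. v \<phi> - w \<phi>) k = fourier_coeff r v k - fourier_coeff r w k"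
  by (simp add: fourier_coeff_def diff_divide_distrib)

text \<open>Dominated convergence with a multiple of the H^s series of \<open>f\<close> as majorant.
  The bound is asked for every \<open>D\<close>, with a constant depending on it: D = 1 controls
  small \<delta> and the limit, while D = \<delta> puts each single \<open>v \<delta>\<close> into
  the space, as \<open>sobolev_limit\<close> requires.\<close>

lemma sobolev_limit_multiplier:
  fixes r :: "real ^ 'n" and B :: "real \<Rightarrow> int ^ 'n \<Rightarrow> real"
  defines "X \<equiv> \<lambda>k :: int ^ 'n. 1 + (norm (\<chi> i. real_of_int (k $ i)))\<^sup>2"
  assumes f: "f \<in> sobolev_space r s"
    and w: "distribution r w" "\<And>k. fourier_coeff r w k = of_real (B0 k) * fourier_coeff r f k"
    and v: "\<And>\<delta>. \<delta> > 0 \<Longrightarrow> distribution r (v \<delta>)"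
      "\<And>\<delta> k. \<delta> > 0 \<Longrightarrow> fourier_coeff r (v \<delta>) k = of_real (B \<delta> k) * fourier_coeff r f k"
    and lim: "\<And>k. ((\<lambda>\<delta>. B \<delta> k) \<longlongrightarrow> B0 k) (at_right 0)"
    and bound: "\<And>D. D > 0 \<Longrightarrow> \<exists>C. \<forall>\<delta> k. 0 < \<delta> \<longrightarrow> \<delta> \<le> D \<longrightarrow>
      X k powr p * (B \<delta> k)\<^sup>2 \<le> C * X k powr s"
  shows "sobolev_limit r p v w"
proof -
  have sob: "sobolev_term r q h k = X k powr q * b\<^sup>2 * (norm (fourier_coeff r f k))\<^sup>2"
    if "fourier_coeff r h k = of_real b * fourier_coeff r f k" for q h b k
    using that by (simp add: sobolev_term_def X_def norm_mult power_mult_distrib)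
  have f_sum: "(\<lambda>k. C * sobolev_term r s f k) summable_on UNIV" for C
    using f by (intro summable_on_cmult_right) (simp add: sobolev_space_def)
  have member: "h \<in> sobolev_space r p"
    if "distribution r h" and h: "\<And>k. fourier_coeff r h k = of_real (b k) * fourier_coeff r f k"
      and b: "\<And>k. X k powr p * (b k)\<^sup>2 \<le> C * X k powr s" for h b C
  proof -
    have "sobolev_term r p h summable_on UNIV"
    proof (rule summable_on_comparison_test[OF f_sum])
      show "sobolev_term r p h k \<le> C * sobolev_term r s f k" for k
        using mult_right_mono[OF b, of "(norm (fourier_coeff r f k))\<^sup>2" k]
        unfolding sob[OF h] by (simp add: sobolev_term_def X_def mult.assoc)
    qed (simp add: sobolev_term_def)
    then show ?thesis using that(1) by (simp add: sobolev_space_def)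
  qed
  obtain C where C: "\<And>\<delta> k. 0 < \<delta> \<Longrightarrow> \<delta> \<le> 1 \<Longrightarrow> X k powr p * (B \<delta> k)\<^sup>2 \<le> C * X k powr s"
    using bound[of 1] by auto
  \<comment> \<open>The uniform estimate passes to the pointwise limit with the same
    constant.\<close>
  have C0: "X k powr p * (B0 k)\<^sup>2 \<le> C * X k powr s" for k
  proof (rule tendsto_upperbound)
    show "((\<lambda>\<delta>. X k powr p * (B \<delta> k)\<^sup>2) \<longlongrightarrow> X k powr p * (B0 k)\<^sup>2) (at_right 0)"
      by (intro tendsto_intros lim)
    show "\<forall>\<^sub>F \<delta> in at_right 0. X k powr p * (B \<delta> k)\<^sup>2 \<le> C * X k powr s"
      using C unfolding eventually_at_right_field by (intro exI[of _ 1]) auto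
  qed simp
  have w_mem: "w \<in> sobolev_space r p" by (rule member[OF w C0])
  have v_mem: "v \<delta> \<in> sobolev_space r p" if pos: "\<delta> > 0" for \<delta>
  proof -
    obtain C' where "\<And>k. X k powr p * (B \<delta> k)\<^sup>2 \<le> C' * X k powr s"
      using bound[OF pos] pos by blast
    then show ?thesis using pos by (intro member[of "v \<delta>" "B \<delta>"] v) auto
  qed
  define T where "T \<delta> k = sobolev_term r p (\<lambda>\<phi>. v \<delta> \<phi> - w \<phi>) k" for \<delta> k
  have T: "T \<delta> k = X k powr p * (B \<delta> k - B0 k)\<^sup>2 * (norm (fourier_coeff r f k))\<^sup>2"
    if "\<delta> > 0" for \<delta> k
    unfolding T_def using that
    by (intro sob) (simp add: fourier_coeff_diff v w left_diff_distrib)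
  \<comment> \<open>The majorant holds only for \<delta> at most 1, so the limit is taken within
    that interval.\<close>
  have at: "at_right (0::real) = at 0 within {0<..1}"
    by (rule at_within_nhd[of _ "{..<1}"]) auto
  have "((\<lambda>\<delta>. \<Sum>\<^sub>\<infinity>k. T \<delta> k) \<longlongrightarrow> 0) (at 0 within {0<..1})"
  proof (rule tendsto_infsum_zero[OF _ _ f_sum])
    fix k
    have "((\<lambda>\<delta>. X k powr p * (B \<delta> k - B0 k)\<^sup>2 * (norm (fourier_coeff r f k))\<^sup>2) \<longlongrightarrow>
        X k powr p * (B0 k - B0 k)\<^sup>2 * (norm (fourier_coeff r f k))\<^sup>2) (at_right 0)"
      by (intro tendsto_intros lim)
    moreover have "\<forall>\<^sub>F \<delta> in at_right 0.
        X k powr p * (B \<delta> k - B0 k)\<^sup>2 * (norm (fourier_coeff r f k))\<^sup>2 = T \<delta> k"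
      by (simp add: eventually_at_filter T)
    ultimately have "((\<lambda>\<delta>. T \<delta> k) \<longlongrightarrow>
        X k powr p * (B0 k - B0 k)\<^sup>2 * (norm (fourier_coeff r f k))\<^sup>2) (at_right 0)"
      by (rule Lim_transform_eventually)
    then have "((\<lambda>\<delta>. T \<delta> k) \<longlongrightarrow> 0) (at_right 0)" by simp
    then show "((\<lambda>\<delta>. T \<delta> k) \<longlongrightarrow> 0) (at 0 within {0<..1})" unfolding at .
  next
    fix \<delta> :: real and k assume \<delta>: "\<delta> \<in> {0<..1}"
    \<comment> \<open>This is the nonnegativity of the square of
      \<open>B \<delta> k + B0 k\<close>.\<close>
    have "(B \<delta> k - B0 k)\<^sup>2 \<le> 2 * (B \<delta> k)\<^sup>2 + 2 * (B0 k)\<^sup>2"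
      using sum_squares_ge_zero[of "B \<delta> k + B0 k" 0] by (simp add: power2_eq_square algebra_simps)
    then have "X k powr p * (B \<delta> k - B0 k)\<^sup>2 \<le> X k powr p * (2 * (B \<delta> k)\<^sup>2 + 2 * (B0 k)\<^sup>2)"
      by (rule mult_left_mono) simp
    also have "\<dots> \<le> 4 * C * X k powr s"
      using C[of \<delta> k] C0[of k] \<delta> by (simp add: algebra_simps)
    finally have "X k powr p * (B \<delta> k - B0 k)\<^sup>2 * (norm (fourier_coeff r f k))\<^sup>2 \<le>
        4 * C * X k powr s * (norm (fourier_coeff r f k))\<^sup>2"
      by (rule mult_right_mono) simp
    then show "norm (T \<delta> k) \<le> 4 * C * sobolev_term r s f k"
      using \<delta> by (simp add: T sobolev_term_def X_def mult_ac)
  qed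
  then have "((\<lambda>\<delta>. sobolev_norm r p (\<lambda>\<phi>. v \<delta> \<phi> - w \<phi>)) \<longlongrightarrow> sqrt 0) (at_right 0)"
    unfolding sobolev_norm_def T_def[symmetric] at by (rule tendsto_real_sqrt)
  then show ?thesis using w_mem v_mem by (simp add: sobolev_limit_def)
qed

section \<open>Sign, limit and upper bound of the multiplier\<close>

lemma multiplier_eq:
  fixes \<nu> :: "real ^ 'n" and \<beta> :: real
  defines "n \<equiv> real CARD('n)"
  defines "a \<equiv> (n + 2 - \<beta>) / 2"
  shows "multiplier \<delta> \<beta> \<nu> = - (norm \<nu>)\<^sup>2 *
    eval_fps (fps_hypergeo [1, a] [2, n / 2 + 1, a + 1] 1) (- ((norm \<nu>)\<^sup>2 * \<delta>\<^sup>2 / 4))"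
proof -
  have "(n + 2) / 2 = n / 2 + 1" "(n + 4 - \<beta>) / 2 = a + 1"
    by (simp_all add: a_def field_simps)
  moreover have "- (1 / 4) * (norm \<nu>)\<^sup>2 * \<delta>\<^sup>2 = - ((norm \<nu>)\<^sup>2 * \<delta>\<^sup>2 / 4)"
    by simp
  ultimately show ?thesis
    unfolding multiplier_def Let_def n_def[symmetric] a_def[symmetric] by (simp only:)
qed

lemma card_half_ge: "real CARD('n::finite) / 2 \<ge> 1 / 2"
  using zero_less_card_finite[where 'a = 'n] by linarith

text \<open>The lower bound for the hypergeometric factor is nonnegative. For t > 0 this gives exp(m
  t) \<le> 1, the estimate used in H^s.\<close>

lemma multiplier_nonpos:
  fixes \<nu> :: "real ^ 'n"
  assumes "\<beta> \<le> real CARD('n) + 2"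
  shows "multiplier \<delta> \<beta> \<nu> \<le> 0"
proof -
  define a where "a = (real CARD('n) + 2 - \<beta>) / 2"
  have "a \<ge> 0" using assms by (simp add: a_def)
  then obtain z0 where "z0 > 0" and z0: "\<And>z. z \<ge> 0 \<Longrightarrow> min 1 ((z0 / z) powr a) / 2 \<le>
      eval_fps (fps_hypergeo [1, a] [2, real CARD('n) / 2 + 1, a + 1] 1) (- z)"
    using hypergeo_2_3_lower_bound[OF _ card_half_ge[where 'n = 'n]] by blast
  from z0[of "(norm \<nu>)\<^sup>2 * \<delta>\<^sup>2 / 4"]
  have "0 \<le> eval_fps (fps_hypergeo [1, a] [2, real CARD('n) / 2 + 1, a + 1] 1)
      (- ((norm \<nu>)\<^sup>2 * \<delta>\<^sup>2 / 4))"
    by (rule order.trans[rotated]) auto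
  then show ?thesis by (simp add: multiplier_eq a_def)
qed

lemma multiplier_tendsto:
  fixes \<nu> :: "real ^ 'n"
  assumes "\<beta> \<le> real CARD('n) + 2"
  shows "((\<lambda>\<delta>. multiplier \<delta> \<beta> \<nu>) \<longlongrightarrow> - (norm \<nu>)\<^sup>2) (at_right 0)"
proof -
  define a where "a = (real CARD('n) + 2 - \<beta>) / 2"
  define F where "F = fps_hypergeo [1, a] [2, real CARD('n) / 2 + 1, a + 1] (1::real)"
  have "fps_conv_radius F = \<infinity>"
    unfolding F_def using assms by (intro fps_conv_radius_hypergeo_2_3) (auto simp: a_def)
  then have "isCont (eval_fps F) 0"
    by (intro continuous_eval_fps) simp
  moreover have "((\<lambda>\<delta>::real. - ((norm \<nu>)\<^sup>2 * \<delta>\<^sup>2 / 4)) \<longlongrightarrow> - ((norm \<nu>)\<^sup>2 * 0\<^sup>2 / 4)) (at_right 0)"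
    by (intro tendsto_intros) simp
  ultimately have "((\<lambda>\<delta>. eval_fps F (- ((norm \<nu>)\<^sup>2 * \<delta>\<^sup>2 / 4))) \<longlongrightarrow> eval_fps F 0) (at_right 0)"
    by (intro isCont_tendsto_compose[of _ "eval_fps F"]) simp_all
  then have "((\<lambda>\<delta>. - (norm \<nu>)\<^sup>2 * eval_fps F (- ((norm \<nu>)\<^sup>2 * \<delta>\<^sup>2 / 4))) \<longlongrightarrow> - (norm \<nu>)\<^sup>2 * 1) (at_right 0)"
    by (intro tendsto_intros) (simp add: eval_fps_at_0 F_def)
  then show ?thesis by (simp add: multiplier_eq a_def F_def)
qed

text \<open>With y = |\<nu>|^2 and z = y \<delta>^2 / 4, replacing \<delta> by \<open>D\<close> can
  only decrease (z0 / z)^a and turns it into a constant times y^(-a). Multiplication by y produces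
  the exponent 1 - a = (\<beta> - n) / 2.\<close>

lemma multiplier_upper_bound:
  fixes \<beta> D :: real
  assumes \<beta>: "\<beta> \<le> real CARD('n) + 2" and D: "D > 0"
  shows "\<exists>q>0. \<forall>\<delta> (\<nu> :: real ^ 'n). 0 < \<delta> \<longrightarrow> \<delta> \<le> D \<longrightarrow>
    multiplier \<delta> \<beta> \<nu> \<le> - q * min ((norm \<nu>)\<^sup>2) ((norm \<nu>)\<^sup>2 powr ((\<beta> - real CARD('n)) / 2))"
proof -
  define a where "a = (real CARD('n) + 2 - \<beta>) / 2"
  have a: "a \<ge> 0" using \<beta> by (simp add: a_def)
  define g where "g z = eval_fps (fps_hypergeo [1, a] [2, real CARD('n) / 2 + 1, a + 1] 1) (- z)" for z
  obtain z0 where z0: "z0 > 0" "\<And>z. z \<ge> 0 \<Longrightarrow> min 1 ((z0 / z) powr a) / 2 \<le> g z"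
    using hypergeo_2_3_lower_bound[OF a card_half_ge[where 'n = 'n]] unfolding g_def by blast
  define b where "b = (4 * z0 / D\<^sup>2) powr a"
  have b: "b > 0" using z0 D by (simp add: b_def)
  have "multiplier \<delta> \<beta> \<nu> \<le> - (min 1 b / 2) * min ((norm \<nu>)\<^sup>2) ((norm \<nu>)\<^sup>2 powr ((\<beta> - real CARD('n)) / 2))"
    if \<delta>: "0 < \<delta>" "\<delta> \<le> D" for \<delta> and \<nu> :: "real ^ 'n"
  proof (cases "\<nu> = 0")
    case False
    define y where "y = (norm \<nu>)\<^sup>2"
    have y: "y > 0" using False by (simp add: y_def)
    have "4 * z0 / D\<^sup>2 / y \<le> z0 / (y * \<delta>\<^sup>2 / 4)"
      using y \<delta> z0 by (simp add: field_simps mult_left_mono power_mono)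
    then have "(4 * z0 / D\<^sup>2 / y) powr a \<le> (z0 / (y * \<delta>\<^sup>2 / 4)) powr a"
      using a y z0 by (intro powr_mono2) auto
    moreover have "(4 * z0 / D\<^sup>2 / y) powr a = b / y powr a"
      unfolding b_def by (rule powr_divide)
    ultimately have "b / y powr a \<le> (z0 / (y * \<delta>\<^sup>2 / 4)) powr a" by simp
    moreover have "0 \<le> y * \<delta>\<^sup>2 / 4" using y by simp
    ultimately have "min 1 (b / y powr a) / 2 \<le> g (y * \<delta>\<^sup>2 / 4)"
      using z0(2) by (meson divide_right_mono min.mono order.refl order.trans zero_le_numeral)
    then have "y * (min 1 (b / y powr a) / 2) \<le> y * g (y * \<delta>\<^sup>2 / 4)"
      using y by (intro mult_left_mono) auto
    also have "y * (min 1 (b / y powr a) / 2) = min y (b * y powr (1 - a)) / 2"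
      using y by (simp add: min_mult_distrib_left powr_diff mult.commute)
    finally have "min y (b * y powr (1 - a)) / 2 \<le> - multiplier \<delta> \<beta> \<nu>"
      by (simp add: multiplier_eq y_def g_def a_def)
    moreover have "min 1 b * min y (y powr (1 - a)) \<le> min y (b * y powr (1 - a))"
    proof (rule min.boundedI)
      have "min 1 b * min y (y powr (1 - a)) \<le> 1 * y"
        using b y by (intro mult_mono) auto
      then show "min 1 b * min y (y powr (1 - a)) \<le> y" by simp
      show "min 1 b * min y (y powr (1 - a)) \<le> b * y powr (1 - a)"
        using b y by (intro mult_mono) auto
    qed
    ultimately have "multiplier \<delta> \<beta> \<nu> \<le> - (min 1 b / 2) * min y (y powr (1 - a))" by linarith
    moreover have "1 - a = (\<beta> - real CARD('n)) / 2" by (simp add: a_def field_simps)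
    ultimately show ?thesis by (simp only: y_def)
  \<comment> \<open>At frequency 0 both sides vanish, since \<open>0 powr x\<close> is 0 for every
    \<open>x\<close>.\<close>
  qed (simp add: multiplier_def)
  moreover have "min 1 b / 2 > 0" using b by simp
  ultimately show ?thesis by blast
qed

section \<open>Decay of the exponential multiplier for \<beta> > n\<close>

lemma norm_freq_ge:
  fixes r :: "real ^ 'n"
  assumes r: "\<And>i. r $ i > 0"
  shows "\<exists>\<rho>>0. \<forall>k. (norm (freq r k))\<^sup>2 \<ge> \<rho> * (norm (\<chi> i. real_of_int (k $ i)))\<^sup>2"
proof -
  have nr: "norm r > 0" using r[of undefined] by auto
  \<comment> \<open>Every side length is at most \<open>norm r\<close>, so \<open>c\<close> bounds
    all factors \<open>2 * pi / r $ i\<close> from below.\<close>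
  define c where "c = 2 * pi / norm r"
  have c: "c > 0" using nr by (simp add: c_def)
  have "(c * norm (\<chi> i. real_of_int (k $ i)))\<^sup>2 \<le> (norm (freq r k))\<^sup>2" for k
  proof -
    have "norm (c *\<^sub>R (\<chi> i. real_of_int (k $ i))) \<le> norm (freq r k)"
    proof (rule norm_le_componentwise_cart)
      fix i
      have "c \<le> 2 * pi / r $ i"
        using component_le_norm_cart[of r i] r[of i] nr by (auto simp: c_def intro!: divide_left_mono)
      then have "c * \<bar>real_of_int (k $ i)\<bar> \<le> 2 * pi / r $ i * \<bar>real_of_int (k $ i)\<bar>"
        by (rule mult_right_mono) simp
      then show "norm ((c *\<^sub>R (\<chi> i. real_of_int (k $ i))) $ i) \<le> norm (freq r k $ i)"
        using c r[of i] by (simp add: freq_def abs_mult)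
    qed
    then show ?thesis using c by (intro power_mono) auto
  qed
  then show ?thesis using c by (intro exI[of _ "c\<^sup>2"]) (simp add: power_mult_distrib)
qed

text \<open>For X \<ge> 1 and N \<ge> p / \<epsilon>, X^p is at most (X^\<epsilon>)^N, and the N-th
  term of the exponential series dominates that power up to a constant.\<close>

lemma powr_le_exp_powr:
  fixes \<epsilon> \<eta> p :: real
  assumes \<epsilon>: "\<epsilon> > 0" and \<eta>: "\<eta> > 0"
  shows "\<exists>C\<ge>0. \<forall>X\<ge>1. X powr p \<le> C * exp (\<eta> * X powr \<epsilon>)"
proof -
  obtain N :: nat where N: "p / \<epsilon> \<le> real N" using real_arch_simple by blast
  have "X powr p \<le> fact N / \<eta> ^ N * exp (\<eta> * X powr \<epsilon>)" if X: "X \<ge> 1" for X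
  proof -
    define Y where "Y = X powr \<epsilon>"
    have "X powr p \<le> X powr (\<epsilon> * real N)"
      using X N \<epsilon> by (intro powr_mono) (auto simp: field_simps)
    also have "\<dots> = Y ^ N"
      using X by (simp add: Y_def powr_powr[symmetric] powr_realpow)
    also have "\<dots> = fact N / \<eta> ^ N * ((\<eta> * Y) ^ N / fact N)"
      using \<eta> by (simp add: power_mult_distrib)
    also have "\<dots> \<le> fact N / \<eta> ^ N * exp (\<eta> * Y)"
    proof (rule mult_left_mono)
      have "(\<Sum>n\<in>{N}. (\<eta> * Y) ^ n /\<^sub>R fact n) \<le> (\<Sum>n. (\<eta> * Y) ^ n /\<^sub>R fact n)"
        using \<eta> by (intro sum_le_suminf summable_exp_generic) (auto simp: Y_def)
      then show "(\<eta> * Y) ^ N / fact N \<le> exp (\<eta> * Y)"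
        by (simp add: exp_def divide_inverse mult.commute)
    qed (use \<eta> in simp)
    finally show ?thesis unfolding Y_def .
  qed
  then show ?thesis using \<eta> by (intro exI[of _ "fact N / \<eta> ^ N"]) simp
qed

text \<open>The bound is uniform for \<open>\<delta> \<le> D\<close>: with \<open>\<epsilon> = (\<beta> - n) / 2 > 0\<close> the multiplier is at most
  \<open>- c (1 + \<parallel>k\<parallel>\<^sup>2)\<^sup>\<epsilon> + C\<close>.\<close>

lemma exp_multiplier_bound:
  fixes r :: "real ^ 'n" and D t :: real
  assumes r: "\<And>i. r $ i > 0" and t: "t > 0" and D: "D > 0"
    and \<beta>: "real CARD('n) < \<beta>" "\<beta> \<le> real CARD('n) + 2"
  defines "X \<equiv> \<lambda>k :: int ^ 'n. 1 + (norm (\<chi> i. real_of_int (k $ i)))\<^sup>2"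
  shows "\<exists>C. \<forall>\<delta> k. 0 < \<delta> \<longrightarrow> \<delta> \<le> D \<longrightarrow>
    X k powr p * (exp (multiplier \<delta> \<beta> (freq r k) * t))\<^sup>2 \<le> C * X k powr s"
proof -
  define \<epsilon> where "\<epsilon> = (\<beta> - real CARD('n)) / 2"
  have \<epsilon>: "0 < \<epsilon>" "\<epsilon> \<le> 1" using \<beta> by (auto simp: \<epsilon>_def)
  obtain q where q: "q > 0" "\<And>\<delta> (\<nu> :: real ^ 'n). 0 < \<delta> \<Longrightarrow> \<delta> \<le> D \<Longrightarrow>
      multiplier \<delta> \<beta> \<nu> \<le> - q * min ((norm \<nu>)\<^sup>2) ((norm \<nu>)\<^sup>2 powr \<epsilon>)"
    using multiplier_upper_bound[OF \<beta>(2) D] unfolding \<epsilon>_def by blast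
  obtain \<rho> where \<rho>: "\<rho> > 0" "\<And>k. (norm (freq r k))\<^sup>2 \<ge> \<rho> * (norm (\<chi> i. real_of_int (k $ i)))\<^sup>2"
    using norm_freq_ge[OF r] by blast
  \<comment> \<open>With this choice, and X^\<epsilon> \<le> X because \<epsilon> \<le> 1, the term
    \<kappa> X^\<epsilon> lies below both X \<rho> / 2 and its power of exponent \<epsilon>, one for
    each entry of the minimum.\<close>
  define \<kappa> where "\<kappa> = min (\<rho> / 2) ((\<rho> / 2) powr \<epsilon>)"
  have \<kappa>: "\<kappa> > 0" using \<rho> by (simp add: \<kappa>_def)
  have X: "X k \<ge> 1" for k by (simp add: X_def)
  have XX: "X k powr \<epsilon> \<le> X k" for k
    using powr_mono[of \<epsilon> 1 "X k"] \<epsilon> X[of k] by simp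
  \<comment> \<open>If X \<ge> 2, then |k|^2 = X - 1 is at least X / 2; otherwise X^\<epsilon> \<le>
    X < 2 and subtracting 2 makes the left side nonpositive.\<close>
  have lower: "\<kappa> * (X k powr \<epsilon> - 2) \<le> min ((norm (freq r k))\<^sup>2) ((norm (freq r k))\<^sup>2 powr \<epsilon>)" for k
  proof (cases "X k \<ge> 2")
    case True
    define y where "y = (norm (freq r k))\<^sup>2"
    have "\<rho> / 2 * X k \<le> \<rho> * (X k - 1)" using True \<rho> by (simp add: field_simps)
    then have y: "\<rho> / 2 * X k \<le> y" using \<rho>(2)[of k] by (simp add: X_def y_def)
    have "\<kappa> * X k powr \<epsilon> \<le> \<rho> / 2 * X k"
      using XX[of k] \<kappa> \<rho> by (intro mult_mono) (auto simp: \<kappa>_def)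
    then have 1: "\<kappa> * X k powr \<epsilon> \<le> y" using y by simp
    have "\<kappa> * X k powr \<epsilon> \<le> (\<rho> / 2) powr \<epsilon> * X k powr \<epsilon>"
      by (intro mult_right_mono) (auto simp: \<kappa>_def)
    also have "\<dots> = (\<rho> / 2 * X k) powr \<epsilon>" using \<rho> X[of k] by (intro powr_mult[symmetric])
    also have "\<dots> \<le> y powr \<epsilon>" using \<epsilon> \<rho> X[of k] y by (intro powr_mono2) auto
    finally show ?thesis using 1 \<kappa> by (simp add: y_def right_diff_distrib)
  next
    case False
    then have "\<kappa> * (X k powr \<epsilon> - 2) \<le> 0"
      using XX[of k] \<kappa> by (intro mult_nonneg_nonpos) auto
    then show ?thesis by (rule order.trans) simp
  qed
  \<comment> \<open>The factor 2 comes from squaring the exponential; the squared multiplier is at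
    most exp(2 \<eta> - \<eta> X^\<epsilon>).\<close>
  define \<eta> where "\<eta> = 2 * t * q * \<kappa>"
  have \<eta>: "\<eta> > 0" using t q \<kappa> by (simp add: \<eta>_def)
  \<comment> \<open>The decay has to compensate the change of Sobolev weight from \<open>s\<close>
    to \<open>p\<close>, a factor X^(p - s).\<close>
  obtain C where C: "C \<ge> 0" "\<And>Y. Y \<ge> 1 \<Longrightarrow> Y powr (p - s) \<le> C * exp (\<eta> * Y powr \<epsilon>)"
    using powr_le_exp_powr[OF \<epsilon>(1) \<eta>] by blast
  have "X k powr p * (exp (multiplier \<delta> \<beta> (freq r k) * t))\<^sup>2 \<le> C * exp (2 * \<eta>) * X k powr s"
    if "0 < \<delta>" "\<delta> \<le> D" for \<delta> k
  proof -
    have "multiplier \<delta> \<beta> (freq r k) \<le> - q * (\<kappa> * (X k powr \<epsilon> - 2))"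
      using q(2)[OF that, of "freq r k"] mult_left_mono[OF lower[of k], of q] q(1)
      by linarith
    then have "2 * t * multiplier \<delta> \<beta> (freq r k) \<le> 2 * t * (- q * (\<kappa> * (X k powr \<epsilon> - 2)))"
      using t by (intro mult_left_mono) auto
    then have "exp (2 * t * multiplier \<delta> \<beta> (freq r k)) \<le> exp (2 * \<eta>) / exp (\<eta> * X k powr \<epsilon>)"
      by (simp add: \<eta>_def algebra_simps flip: exp_diff)
    then have "X k powr (p - s) * exp (2 * t * multiplier \<delta> \<beta> (freq r k)) \<le>
        C * exp (\<eta> * X k powr \<epsilon>) * (exp (2 * \<eta>) / exp (\<eta> * X k powr \<epsilon>))"
      using C X[of k] by (intro mult_mono) auto
    also have "\<dots> = C * exp (2 * \<eta>)" by simp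
    finally have "X k powr (p - s) * exp (2 * t * multiplier \<delta> \<beta> (freq r k)) * X k powr s \<le>
        C * exp (2 * \<eta>) * X k powr s"
      by (rule mult_right_mono) simp
    moreover have "X k powr p = X k powr (p - s) * X k powr s"
      by (simp flip: powr_add)
    moreover have "(exp (multiplier \<delta> \<beta> (freq r k) * t))\<^sup>2 = exp (2 * t * multiplier \<delta> \<beta> (freq r k))"
      by (simp add: algebra_simps flip: exp_double)
    ultimately show ?thesis by (simp add: mult_ac)
  qed
  then show ?thesis by blast
qed

section \<open>Convergence of the nonlocal solutions in both ranges of \<beta>\<close>

theorem theorem7:
  fixes r :: "real ^ 'n" and s \<beta> :: real
    and f :: "'n functional"
    and u :: "real \<Rightarrow> 'n functional"
    and u\<delta> :: "real \<Rightarrow> real \<Rightarrow> 'n functional"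
  assumes "\<And>i. r $ i > 0"
    and "f \<in> sobolev_space r s"
    and "evolution_solution r laplacian f u"
    and "\<And>\<delta>. \<delta> > 0 \<Longrightarrow> evolution_solution r (nonlocal_op r \<delta> \<beta>) f (u\<delta> \<delta>)"
  shows "(\<forall>t>0. \<beta> \<le> real CARD('n) \<longrightarrow> sobolev_limit r s (\<lambda>\<delta>. u\<delta> \<delta> t) (u t)) \<and>
    (\<forall>t>0. real CARD('n) < \<beta> \<and> \<beta> \<le> real CARD('n) + 2 \<longrightarrow>
        sobolev_limit_infinity r (\<lambda>\<delta>. u\<delta> \<delta> t) (u t))"
proof -
  let ?X = "\<lambda>k :: int ^ 'n. 1 + (norm (\<chi> i. real_of_int (k $ i)))\<^sup>2"
  \<comment> \<open>Common reduction: the two ranges of \<beta> differ only in the target exponent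
    \<open>p\<close> and in how the exponential multiplier is bounded.\<close>
  have limit: "sobolev_limit r p (\<lambda>\<delta>. u\<delta> \<delta> t) (u t)"
    if t: "t > 0" and \<beta>: "\<beta> \<le> real CARD('n) + 2"
      and bound: "\<And>D. D > 0 \<Longrightarrow> \<exists>C. \<forall>\<delta> k. 0 < \<delta> \<longrightarrow> \<delta> \<le> D \<longrightarrow>
        ?X k powr p * (exp (multiplier \<delta> \<beta> (freq r k) * t))\<^sup>2 \<le> C * ?X k powr s" for t p
  proof (rule sobolev_limit_multiplier[OF assms(2) _ _ _ _ _ bound])
    show "distribution r (u t)" "\<And>\<delta>. 0 < \<delta> \<Longrightarrow> distribution r (u\<delta> \<delta> t)"
      using assms(3,4) t by (auto simp: evolution_solution_def)
    show "fourier_coeff r (u t) k =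
        of_real (exp (- (norm (freq r k))\<^sup>2 * t)) * fourier_coeff r f k" for k
      by (rule fourier_coeff_evolution_solution[OF assms(1,3) fourier_coeff_laplacian[OF assms(1)] t])
    show "fourier_coeff r (u\<delta> \<delta> t) k =
        of_real (exp (multiplier \<delta> \<beta> (freq r k) * t)) * fourier_coeff r f k" if "\<delta> > 0" for \<delta> k
      by (rule fourier_coeff_evolution_solution[OF assms(1) assms(4)[OF that]
            fourier_coeff_nonlocal_op[OF assms(1)] t])
    show "((\<lambda>\<delta>. exp (multiplier \<delta> \<beta> (freq r k) * t)) \<longlongrightarrow>
        exp (- (norm (freq r k))\<^sup>2 * t)) (at_right 0)" for k
      by (intro tendsto_intros multiplier_tendsto \<beta>)
  qed
  show ?thesis
  proof (intro conjI allI impI)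
    fix t :: real assume t: "t > 0" and \<beta>: "\<beta> \<le> real CARD('n)"
    \<comment> \<open>For \<open>p = s\<close> the weights agree, and nonpositivity of the
      multiplier gives the constant 1 for every \<delta>.\<close>
    have "?X k powr s * (exp (multiplier \<delta> \<beta> (freq r k) * t))\<^sup>2 \<le> 1 * ?X k powr s" for \<delta> k
    proof -
      have "multiplier \<delta> \<beta> (freq r k) \<le> 0" using \<beta> by (intro multiplier_nonpos) simp
      then have "(exp (multiplier \<delta> \<beta> (freq r k) * t))\<^sup>2 \<le> 1"
        using t by (simp add: power_le_one mult_nonpos_nonneg)
      then show ?thesis using mult_left_mono[of _ 1 "?X k powr s"] by simp
    qed
    then show "sobolev_limit r s (\<lambda>\<delta>. u\<delta> \<delta> t) (u t)"
      using t \<beta> by (intro limit) (auto intro!: exI[of _ 1])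
  next
    fix t :: real assume "t > 0" and "real CARD('n) < \<beta> \<and> \<beta> \<le> real CARD('n) + 2"
    then show "sobolev_limit_infinity r (\<lambda>\<delta>. u\<delta> \<delta> t) (u t)"
      unfolding sobolev_limit_infinity_def
      by (intro allI limit exp_multiplier_bound assms(1)) auto
  qed
qed

end
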